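(* Let $\mathbb{K}$ be a field and let $G$ be a connected simple graph on $n$ vertices. For a labeling of the vertices of $G$ by $[n]=\{1,\dots,n\}$, let $J_G=\bigcap_{S\subseteq[n]}P_S$ be the primary decomposition of its binomial edge ideal in $R=\mathbb{K}[x_1,\dots,x_n,y_1,\dots,y_n]$. The following are equivalent: (1) $G$ is weakly closed; (2) there exists a labeling of the vertices of $G$ by $[n]$ such that $P_S=\overline{P}_S$ for every minimal prime $P_S$ of $J_G$ (that is, every minimal prime of $J_G$ equals the associated sum $\overline{P}_S$ of determinantal ideals on adjacent columns).
   Context: For a simple graph $G$ with vertices labeled by $[n]$ and edge set $E(G)$, the binomial edge ideal is $J_G=(x_iy_j-x_jy_i \mid \{i,j\}\in E(G))\subseteq R$. $G$ is weakly closed if there exists a labeling of its vertices by $[n]$ such that for all integers $1\le i<j<k\le n$, if $\{i,k\}\in E(G)$ then $\{i,j\}\in E(G)$ or $\{j,k\}\in E(G)$. For $S\subseteq[n]$ let $G_1,\dots,G_{c(S)}$ be the connected components of the restriction of $G$ to $[n]\setminus S$, and let $\widetilde{G}_i$ be the complete graph on the vertex set of $G_i$. Set $P_S=(x_s,y_s\mid s\in S)+J_{\widetilde{G}_1}+\dots+J_{\widetilde{G}_{c(S)}}$. Each $P_S$ is prime and $J_G=\bigcap_{S\subseteq[n]}P_S$ (so every minimal prime of $J_G$ is some $P_S$). Let $X$ be the $2\times n$ matrix with rows $(x_1,\dots,x_n)$ and $(y_1,\dots,y_n)$; $X_{[a,b]}$ is the submatrix of columns $a,a+1,\dots,b$ and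 $I_2(X_{[a,b]})$ is the ideal generated by its $2$-minors (zero if $a=b$). With $a_i$ and $b_i$ the smallest and largest vertices of $G_i$, set $\overline{P}_S=(x_s,y_s\mid s\in S)+I_2(X_{[a_1,b_1]})+\dots+I_2(X_{[a_{c(S)},b_{c(S)}]})$. *)

theory Defs
  imports
    "HOL-Library.Poly_Mapping"
    "HOL-Algebra.Ideal"
    "Graph_Theory.Graph_Theory"
begin

datatype var = XVar nat | YVar nat

type_synonym 'k mpoly = "(var \<Rightarrow>\<^sub>0 nat) \<Rightarrow>\<^sub>0 'k"

definition indet :: "var \<Rightarrow> 'k::field mpoly" where
  "indet v = Poly_Mapping.single (Poly_Mapping.single v 1) 1"

text \<open>
  The type \<^typ>\<open>'k mpoly\<close> has the ring operations of polynomials in all variables; the carrier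
  consists of the polynomials in which only variables with index in \<open>{1..n}\<close> occur.
\<close>

definition poly_ring :: "nat \<Rightarrow> 'k::field mpoly ring" where
  "poly_ring n =
    \<lparr>carrier = {p. \<forall>m \<in> Poly_Mapping.keys p.
        Poly_Mapping.keys m \<subseteq> XVar ` {1..n} \<union> YVar ` {1..n}},
     monoid.mult = (*), one = 1, zero = 0, add = (+)\<rparr>"

lemma cring_poly_ring: "cring (poly_ring n :: 'k::field mpoly ring)"
proof -
  define V where "V = XVar ` {1..n} \<union> YVar ` {1..n}"
  define R where "R = (poly_ring n :: 'k mpoly ring)"
  have carrier: "p \<in> carrier R \<longleftrightarrow> (\<forall>m \<in> Poly_Mapping.keys p. Poly_Mapping.keys m \<subseteq> V)"
    for p
    by (simp add: R_def poly_ring_def V_def)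
  have ops: "p \<oplus>\<^bsub>R\<^esub> q = p + q" "p \<otimes>\<^bsub>R\<^esub> q = p * q" "\<zero>\<^bsub>R\<^esub> = 0" "\<one>\<^bsub>R\<^esub> = 1"
    for p q
    by (simp_all add: R_def poly_ring_def)
  have zero: "0 \<in> carrier R" and one: "1 \<in> carrier R"
    by (simp_all add: carrier)
  have minus: "- p \<in> carrier R" if "p \<in> carrier R" for p
    using that by (simp add: carrier)
  have plus: "p + q \<in> carrier R" if "p \<in> carrier R" "q \<in> carrier R" for p q
    using that Poly_Mapping.keys_add[of p q] unfolding carrier by blast
  have times: "p * q \<in> carrier R" if p: "p \<in> carrier R" and q: "q \<in> carrier R" for p q
    unfolding carrier
  proof
    fix m assume "m \<in> Poly_Mapping.keys (p * q)"
    then obtain a b where "m = a + b" "a \<in> Poly_Mapping.keys p" "b \<in> Poly_Mapping.keys q"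
      using keys_mult[of p q] by blast
    then show "Poly_Mapping.keys m \<subseteq> V"
      using p q Poly_Mapping.keys_add[of a b] unfolding carrier by blast
  qed
  have "cring R"
  proof (rule cringI)
    show "abelian_group R"
    proof (rule abelian_groupI)
      show "\<exists>q\<in>carrier R. q \<oplus>\<^bsub>R\<^esub> p = \<zero>\<^bsub>R\<^esub>" if "p \<in> carrier R" for p
        using minus[OF that] unfolding ops by (intro bexI[of _ "- p"]) simp_all
    qed (simp_all only: ops zero plus ac_simps add_0_left add_0_right)
    show "comm_monoid R"
      by (rule comm_monoidI) (simp_all only: ops one times ac_simps mult_1_left mult_1_right)
  qed (simp only: ops distrib_right)
  then show ?thesis
    by (simp only: R_def)
qed

definition minor2 :: "nat \<Rightarrow> nat \<Rightarrow> 'k::field mpoly" where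
  "minor2 i j = indet (XVar i) * indet (YVar j) - indet (XVar j) * indet (YVar i)"

definition minors_ideal :: "nat \<Rightarrow> nat \<Rightarrow> nat \<Rightarrow> 'k::field mpoly set" where
  "minors_ideal n a b = Idl\<^bsub>poly_ring n\<^esub> {minor2 i j | i j. a \<le> i \<and> i < j \<and> j \<le> b}"

text \<open>
  The sum of a family of ideals is the ideal generated by its union; in the binary case this is
  \<open>I <+> J\<close> (\<open>ring.union_genideal\<close>).
\<close>

definition ideal_sum :: "('a, 'b) ring_scheme \<Rightarrow> 'a set set \<Rightarrow> 'a set" where
  "ideal_sum R F = Idl\<^bsub>R\<^esub> (\<Union> F)"

definition minimal_primes :: "('a, 'b) ring_scheme \<Rightarrow> 'a set \<Rightarrow> 'a set set" where
  "minimal_primes R J =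
    {P. primeideal P R \<and> J \<subseteq> P \<and> (\<forall>Q. primeideal Q R \<and> J \<subseteq> Q \<and> Q \<subseteq> P \<longrightarrow> Q = P)}"

text \<open>
  Simple graphs are \<^locale>\<open>pair_graph\<close>s: an edge \<open>{u, v}\<close> is the pair of arcs \<open>(u, v)\<close>, \<open>(v, u)\<close>.
\<close>

definition labeling :: "('v \<Rightarrow> nat) \<Rightarrow> 'v pair_pre_digraph \<Rightarrow> bool" where
  "labeling l G \<longleftrightarrow> bij_betw l (pverts G) {1..card (pverts G)}"

definition relabel :: "('v \<Rightarrow> 'w) \<Rightarrow> 'v pair_pre_digraph \<Rightarrow> 'w pair_pre_digraph" where
  "relabel l G = \<lparr>pverts = l ` pverts G, parcs = map_prod l l ` parcs G\<rparr>"

definition weakly_closed :: "'v pair_pre_digraph \<Rightarrow> bool" where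
  "weakly_closed G \<longleftrightarrow>
    (\<exists>l. labeling l G \<and>
      (\<forall>i j k. 1 \<le> i \<and> i < j \<and> j < k \<and> k \<le> card (pverts G) \<longrightarrow>
        (i, k) \<in> parcs (relabel l G) \<longrightarrow>
        (i, j) \<in> parcs (relabel l G) \<or> (j, k) \<in> parcs (relabel l G)))"

text \<open>
  In a symmetric digraph the strongly connected components are the connected components of the
  underlying undirected graph.
\<close>

definition components_minus :: "'v pair_pre_digraph \<Rightarrow> 'v set \<Rightarrow> 'v set set" where
  "components_minus G S = pre_digraph.sccs_verts (with_proj G \<restriction> (pverts G - S))"

definition complete_on :: "'v set \<Rightarrow> 'v pair_pre_digraph" where
  "complete_on V = \<lparr>pverts = V, parcs = {(u, v). u \<in> V \<and> v \<in> V \<and> u \<noteq> v}\<rparr>"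

text \<open>
  Each edge contributes both \<open>minor2 i j\<close> and its negative \<open>minor2 j i\<close> as generators.
\<close>

definition binomial_edge_ideal :: "nat \<Rightarrow> nat pair_pre_digraph \<Rightarrow> 'k::field mpoly set" where
  "binomial_edge_ideal n G = Idl\<^bsub>poly_ring n\<^esub> {minor2 i j | i j. (i, j) \<in> parcs G}"

definition var_ideal :: "nat \<Rightarrow> nat set \<Rightarrow> 'k::field mpoly set" where
  "var_ideal n S = Idl\<^bsub>poly_ring n\<^esub> (indet ` (XVar ` S \<union> YVar ` S))"

definition P_ideal :: "nat \<Rightarrow> nat pair_pre_digraph \<Rightarrow> nat set \<Rightarrow> 'k::field mpoly set" where
  "P_ideal n G S = ideal_sum (poly_ring n)
    (insert (var_ideal n S)
      ((\<lambda>C. binomial_edge_ideal n (complete_on C)) ` components_minus G S))"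

definition P_bar_ideal :: "nat \<Rightarrow> nat pair_pre_digraph \<Rightarrow> nat set \<Rightarrow> 'k::field mpoly set" where
  "P_bar_ideal n G S = ideal_sum (poly_ring n)
    (insert (var_ideal n S)
      ((\<lambda>C. minors_ideal n (Min C) (Max C)) ` components_minus G S))"

end

theory Submission
  imports Defs
begin

text \<open>
  A labeling makes the graph weakly closed if and only if this same labeling satisfies the condition on
  minimal primes, so the equivalence is proved for one labeling at a time, identifying vertices with
  their numbers.

  The ideal \<open>P\<^sub>S\<close> says of a \<open>2 \<times> n\<close> matrix that the columns in \<open>S\<close> vanish and that the
  columns in each component of the graph without \<open>S\<close> are proportional. It is the kernel of the
  homomorphism \<open>x\<^sub>i \<mapsto> a\<^sub>c t\<^sub>i\<close>, \<open>y\<^sub>i \<mapsto> t\<^sub>i\<close> (\<open>c\<close> the component of \<open>i\<close>) that kills the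
  variables of \<open>S\<close> (\<open>P_ideal_eq_toric_ideal\<close>): two monomials with the same nonzero image are
  connected by moves \<open>x\<^sub>i y\<^sub>j \<leftrightarrow> x\<^sub>j y\<^sub>i\<close> inside components (\<open>binomial_in_ideal\<close>). Therefore
  \<open>P\<^sub>S\<close> is prime over every field, finite ones included, and it contains the minor of columns \<open>i, j\<close>
  if and only if one of them is in \<open>S\<close> or both are in one component. It follows that \<open>P\<^sub>S\<close> equals its
  companion generated by minors of intervals of columns exactly if each component \<open>C\<close> contains every
  vertex of \<open>{Min C..Max C}\<close> that is not in \<open>S\<close> (\<open>P_ideal_eq_P_bar_ideal_iff\<close>).

  A weakly closed labeling has this interval property for every \<open>S\<close>: an edge of \<open>C\<close> cannot jump over
  a vertex outside \<open>S\<close> without an end adjacent to it. If the labeling is not weakly closed, witnessed by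
  \<open>i < j < k\<close>, the interval property fails for the complement \<open>S\<close> of \<open>{i, j, k}\<close>. This \<open>P\<^sub>S\<close> need
  not be a minimal prime, but it contains a minimal prime \<open>P\<^sub>T\<close> (\<open>minimal_prime_below_P_ideal\<close>), since every
  prime over the binomial edge ideal contains some \<open>P\<^sub>U\<close> (\<open>prime_contains_P_ideal\<close>). The property
  fails for \<open>T\<close> as well: \<open>T \<subseteq> S\<close>, and \<open>j\<close> cannot be in the component of \<open>i\<close> and \<open>k\<close>, since otherwise
  the minor of columns \<open>i, j\<close> would lie in \<open>P\<^sub>T \<subseteq> P\<^sub>S\<close>.
\<close>

section \<open>Linear extension of maps on monomials\<close>

text \<open>
  The values of \<open>\<mu>\<close> are elements of the target algebra rather than monomials, so that some monomials
  can be sent to \<open>0\<close>.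
\<close>

definition linear_ext :: "('a \<Rightarrow> ('b \<Rightarrow>\<^sub>0 'k)) \<Rightarrow> ('a \<Rightarrow>\<^sub>0 'k) \<Rightarrow> ('b::comm_monoid_add \<Rightarrow>\<^sub>0 'k::comm_ring_1)"
  where "linear_ext \<mu> p = (\<Sum>m\<in>Poly_Mapping.keys p. Poly_Mapping.single 0 (Poly_Mapping.lookup p m) * \<mu> m)"

lemma linear_ext_superset:
  assumes "finite A" "Poly_Mapping.keys p \<subseteq> A"
  shows "linear_ext \<mu> p = (\<Sum>m\<in>A. Poly_Mapping.single 0 (Poly_Mapping.lookup p m) * \<mu> m)"
  unfolding linear_ext_def using assms
  by (intro sum.mono_neutral_left) (auto simp: in_keys_iff)

lemma linear_ext_zero [simp]: "linear_ext \<mu> 0 = 0"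
  by (simp add: linear_ext_def)

lemma linear_ext_single [simp]:
  "linear_ext \<mu> (Poly_Mapping.single m c) = Poly_Mapping.single 0 c * \<mu> m"
  by (subst linear_ext_superset[of "{m}"]) auto

lemma linear_ext_add: "linear_ext \<mu> (p + q) = linear_ext \<mu> p + linear_ext \<mu> q"
proof -
  let ?A = "Poly_Mapping.keys p \<union> Poly_Mapping.keys q"
  have "linear_ext \<mu> f = (\<Sum>m\<in>?A. Poly_Mapping.single 0 (Poly_Mapping.lookup f m) * \<mu> m)"
    if "f \<in> {p, q, p + q}" for f
    using that Poly_Mapping.keys_add[of p q] by (intro linear_ext_superset) auto
  then show ?thesis
    by (simp add: lookup_add single_add distrib_right sum.distrib)
qed

lemma linear_ext_uminus: "linear_ext \<mu> (- p) = - linear_ext \<mu> p"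
  using linear_ext_add[of \<mu> p "- p"] by (simp add: eq_neg_iff_add_eq_0 add.commute)

lemma linear_ext_diff: "linear_ext \<mu> (p - q) = linear_ext \<mu> p - linear_ext \<mu> q"
  using linear_ext_add[of \<mu> p "- q"] by (simp add: linear_ext_uminus)

lemma linear_ext_sum: "linear_ext \<mu> (\<Sum>x\<in>A. f x) = (\<Sum>x\<in>A. linear_ext \<mu> (f x))"
  by (induction A rule: infinite_finite_induct) (simp_all add: linear_ext_add)

lemma sum_single_lookup: "(\<Sum>m\<in>Poly_Mapping.keys p. Poly_Mapping.single m (Poly_Mapping.lookup p m)) = p"
  by (rule poly_mapping_eqI)
    (auto simp: lookup_sum lookup_single when_def in_keys_iff sum.delta')

lemma linear_ext_mult:
  assumes "\<And>a b. \<mu> (a + b) = \<mu> a * \<mu> b"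
  shows "linear_ext \<mu> (p * q) = linear_ext \<mu> p * linear_ext \<mu> q"
proof -
  let ?s = "\<lambda>p m. Poly_Mapping.single m (Poly_Mapping.lookup p m)"
  have one: "linear_ext \<mu> (Poly_Mapping.single a c * Poly_Mapping.single b d)
      = linear_ext \<mu> (Poly_Mapping.single a c) * linear_ext \<mu> (Poly_Mapping.single b d)" for a b c d
  proof -
    have "(Poly_Mapping.single 0 (c * d) :: 'b \<Rightarrow>\<^sub>0 'c)
        = Poly_Mapping.single 0 c * Poly_Mapping.single 0 d"
      by (simp add: mult_single)
    then show ?thesis
      by (simp add: mult_single assms mult_ac)
  qed
  have "p * q = (\<Sum>a\<in>Poly_Mapping.keys p. ?s p a) * (\<Sum>b\<in>Poly_Mapping.keys q. ?s q b)"
    by (simp only: sum_single_lookup)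
  also have "linear_ext \<mu> \<dots> = linear_ext \<mu> (\<Sum>a\<in>Poly_Mapping.keys p. ?s p a)
      * linear_ext \<mu> (\<Sum>b\<in>Poly_Mapping.keys q. ?s q b)"
    by (simp only: sum_product linear_ext_sum one)
  finally show ?thesis
    by (simp only: sum_single_lookup)
qed

lemma single_eq_0_iff: "Poly_Mapping.single m c = 0 \<longleftrightarrow> c = 0"
  by (metis lookup_single_eq lookup_zero single_zero)

lemma single_1_eq_iff:
  "Poly_Mapping.single a (1 :: 'k::zero_neq_one) = Poly_Mapping.single b 1 \<longleftrightarrow> a = b"
  by (metis lookup_single_eq lookup_single_not_eq zero_neq_one)

lemma keys_add_nat: "Poly_Mapping.keys (a + b) = Poly_Mapping.keys a \<union> Poly_Mapping.keys (b :: 'a \<Rightarrow>\<^sub>0 nat)"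
  by (auto simp: in_keys_iff lookup_add)

section \<open>Ideals of the polynomial ring\<close>

lemma mem_poly_ring: "p \<in> carrier (poly_ring n) \<longleftrightarrow>
    (\<forall>m\<in>Poly_Mapping.keys p. Poly_Mapping.keys m \<subseteq> XVar ` {1..n} \<union> YVar ` {1..n})"
  by (simp add: poly_ring_def)

lemma poly_ring_ops [simp]:
  "p \<oplus>\<^bsub>poly_ring n\<^esub> q = p + q" "p \<otimes>\<^bsub>poly_ring n\<^esub> q = p * q"
  "\<zero>\<^bsub>poly_ring n\<^esub> = 0" "\<one>\<^bsub>poly_ring n\<^esub> = 1"
  by (simp_all add: poly_ring_def)

lemma ring_poly_ring: "ring (poly_ring n :: 'k::field mpoly ring)"
  using cring_poly_ring cring.axioms(1) by blast

lemma single_in_poly_ring: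
  "Poly_Mapping.keys m \<subseteq> XVar ` {1..n} \<union> YVar ` {1..n} \<Longrightarrow>
    Poly_Mapping.single m c \<in> carrier (poly_ring n)"
  by (auto simp: mem_poly_ring)

lemma poly_ring_uminus:
  "p \<in> carrier (poly_ring n) \<Longrightarrow> - p \<in> carrier (poly_ring n)"
  by (auto simp: mem_poly_ring)

lemma indet_in_poly_ring:
  "i \<in> {1..n} \<Longrightarrow> indet (XVar i) \<in> carrier (poly_ring n)"
  "i \<in> {1..n} \<Longrightarrow> indet (YVar i) \<in> carrier (poly_ring n)"
  by (auto simp: indet_def intro!: single_in_poly_ring)

lemma minor2_eq_binomial:
  "minor2 i j = Poly_Mapping.single (Poly_Mapping.single (XVar i) 1 + Poly_Mapping.single (YVar j) 1) 1
     - Poly_Mapping.single (Poly_Mapping.single (XVar j) 1 + Poly_Mapping.single (YVar i) 1) 1"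
  by (simp add: minor2_def indet_def mult_single)

lemma minor2_swap: "minor2 j i = - minor2 i j"
  by (simp add: minor2_def)

lemma minor2_in_poly_ring:
  assumes "i \<in> {1..n}" "j \<in> {1..n}"
  shows "minor2 i j \<in> carrier (poly_ring n)"
proof -
  let ?m = "\<lambda>i j. Poly_Mapping.single (Poly_Mapping.single (XVar i) (1::nat) + Poly_Mapping.single (YVar j) 1) 1"
  have "?m i j \<in> carrier (poly_ring n)" "?m j i \<in> carrier (poly_ring n)"
    using assms by (auto simp: keys_add_nat intro!: single_in_poly_ring)
  then have "?m i j - ?m j i \<in> carrier (poly_ring n)"
    unfolding mem_poly_ring using keys_diff[of "?m i j" "?m j i"] by blast
  then show ?thesis
    by (simp add: minor2_eq_binomial)
qed

lemma ideal_poly_ring: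
  assumes "ideal I (poly_ring n :: 'k::field mpoly ring)"
  shows ideal_poly_ring_subset: "I \<subseteq> carrier (poly_ring n)"
    and ideal_poly_ring_zero: "0 \<in> I"
    and ideal_poly_ring_add: "p \<in> I \<Longrightarrow> q \<in> I \<Longrightarrow> p + q \<in> I"
    and ideal_poly_ring_mult: "c \<in> carrier (poly_ring n) \<Longrightarrow> p \<in> I \<Longrightarrow> c * p \<in> I"
    and ideal_poly_ring_uminus: "p \<in> I \<Longrightarrow> - p \<in> I"
proof -
  interpret ideal I "poly_ring n" by (rule assms)
  show "I \<subseteq> carrier (poly_ring n)" by (rule a_subset)
  show "0 \<in> I" using additive_subgroup.zero_closed[OF is_additive_subgroup] by simp
  show "p \<in> I \<Longrightarrow> q \<in> I \<Longrightarrow> p + q \<in> I" using additive_subgroup.a_closed[OF is_additive_subgroup, of p q] by simp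
  show mult: "c \<in> carrier (poly_ring n) \<Longrightarrow> p \<in> I \<Longrightarrow> c * p \<in> I" for c p
    using I_l_closed[of p c] by simp
  have "- 1 \<in> carrier (poly_ring n)"
    by (simp add: mem_poly_ring)
  then show "p \<in> I \<Longrightarrow> - p \<in> I"
    using mult[of "- 1" p] by simp
qed

lemma ideal_poly_ring_sum:
  "ideal I (poly_ring n) \<Longrightarrow> (\<And>x. x \<in> A \<Longrightarrow> f x \<in> I) \<Longrightarrow> (\<Sum>x\<in>A. f x) \<in> I"
  by (induction A rule: infinite_finite_induct)
    (simp_all add: ideal_poly_ring_zero ideal_poly_ring_add)

lemma ideal_Idl_poly_ring:
  assumes "B \<subseteq> carrier (poly_ring n :: 'k::field mpoly ring)"
  shows "ideal (Idl\<^bsub>poly_ring n\<^esub> B) (poly_ring n)" and "B \<subseteq> Idl\<^bsub>poly_ring n\<^esub> B"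
  using ring.genideal_ideal[OF ring_poly_ring assms] ring.genideal_self[OF ring_poly_ring assms] by auto

lemma Idl_poly_ring_subset_iff:
  assumes "B \<subseteq> carrier (poly_ring n :: 'k::field mpoly ring)" "ideal I (poly_ring n)"
  shows "Idl\<^bsub>poly_ring n\<^esub> B \<subseteq> I \<longleftrightarrow> B \<subseteq> I"
  using ring.genideal_minimal[OF ring_poly_ring assms(2)] ideal_Idl_poly_ring(2)[OF assms(1)] by blast

lemma ideal_sum_subset_iff:
  assumes "\<And>J. J \<in> F \<Longrightarrow> ideal J (poly_ring n :: 'k::field mpoly ring)" "ideal I (poly_ring n)"
  shows "ideal_sum (poly_ring n) F \<subseteq> I \<longleftrightarrow> (\<forall>J\<in>F. J \<subseteq> I)"
  unfolding ideal_sum_def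
  using Idl_poly_ring_subset_iff[of "\<Union> F", OF _ assms(2)] ideal_poly_ring_subset[OF assms(1)] by blast

lemma ideal_ideal_sum:
  assumes "\<And>J. J \<in> F \<Longrightarrow> ideal J (poly_ring n :: 'k::field mpoly ring)"
  shows "ideal (ideal_sum (poly_ring n) F) (poly_ring n)"
  unfolding ideal_sum_def
  using ideal_poly_ring_subset[OF assms] by (intro ideal_Idl_poly_ring) blast

lemma
  assumes "S \<subseteq> {1..n}"
  shows ideal_var_ideal: "ideal (var_ideal n S) (poly_ring n :: 'k::field mpoly ring)"
    and var_ideal_subset_iff: "ideal I (poly_ring n) \<Longrightarrow> (var_ideal n S :: 'k mpoly set) \<subseteq> I
      \<longleftrightarrow> (\<forall>i\<in>S. indet (XVar i) \<in> I \<and> indet (YVar i) \<in> I)"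
proof -
  have B: "indet ` (XVar ` S \<union> YVar ` S) \<subseteq> carrier (poly_ring n :: 'k mpoly ring)"
    using assms indet_in_poly_ring by blast
  show "ideal (var_ideal n S) (poly_ring n :: 'k::field mpoly ring)"
    unfolding var_ideal_def by (rule ideal_Idl_poly_ring(1)[OF B])
  show "ideal I (poly_ring n) \<Longrightarrow> (var_ideal n S :: 'k mpoly set) \<subseteq> I
      \<longleftrightarrow> (\<forall>i\<in>S. indet (XVar i) \<in> I \<and> indet (YVar i) \<in> I)"
    unfolding var_ideal_def Idl_poly_ring_subset_iff[OF B] by blast
qed

lemma
  assumes "parcs K \<subseteq> {1..n} \<times> {1..n}"
  shows ideal_binomial_edge_ideal: "ideal (binomial_edge_ideal n K) (poly_ring n :: 'k::field mpoly ring)"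
    and binomial_edge_ideal_subset_iff: "ideal I (poly_ring n) \<Longrightarrow> (binomial_edge_ideal n K :: 'k mpoly set) \<subseteq> I
      \<longleftrightarrow> (\<forall>(i, j)\<in>parcs K. minor2 i j \<in> I)"
proof -
  have B: "{minor2 i j |i j. (i, j) \<in> parcs K} \<subseteq> carrier (poly_ring n :: 'k mpoly ring)"
  proof clarify
    fix i j assume "(i, j) \<in> parcs K"
    then have "i \<in> {1..n}" "j \<in> {1..n}" using assms by auto
    then show "minor2 i j \<in> carrier (poly_ring n)" by (rule minor2_in_poly_ring)
  qed
  show "ideal (binomial_edge_ideal n K) (poly_ring n :: 'k::field mpoly ring)"
    unfolding binomial_edge_ideal_def by (rule ideal_Idl_poly_ring(1)[OF B])
  show "ideal I (poly_ring n) \<Longrightarrow> (binomial_edge_ideal n K :: 'k mpoly set) \<subseteq> I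
      \<longleftrightarrow> (\<forall>(i, j)\<in>parcs K. minor2 i j \<in> I)"
    unfolding binomial_edge_ideal_def Idl_poly_ring_subset_iff[OF B] by blast
qed

lemma
  assumes "1 \<le> a" "b \<le> n"
  shows ideal_minors_ideal: "ideal (minors_ideal n a b) (poly_ring n :: 'k::field mpoly ring)"
    and minors_ideal_subset_iff: "ideal I (poly_ring n) \<Longrightarrow> (minors_ideal n a b :: 'k mpoly set) \<subseteq> I
      \<longleftrightarrow> (\<forall>i j. a \<le> i \<and> i < j \<and> j \<le> b \<longrightarrow> minor2 i j \<in> I)"
proof -
  have B: "{minor2 i j |i j. a \<le> i \<and> i < j \<and> j \<le> b} \<subseteq> carrier (poly_ring n :: 'k mpoly ring)"
  proof clarify
    fix i j assume "a \<le> i" "i < j" "j \<le> b"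
    then have "i \<in> {1..n}" "j \<in> {1..n}" using assms by auto
    then show "minor2 i j \<in> carrier (poly_ring n)" by (rule minor2_in_poly_ring)
  qed
  show "ideal (minors_ideal n a b) (poly_ring n :: 'k::field mpoly ring)"
    unfolding minors_ideal_def by (rule ideal_Idl_poly_ring(1)[OF B])
  show "ideal I (poly_ring n) \<Longrightarrow> (minors_ideal n a b :: 'k mpoly set) \<subseteq> I
      \<longleftrightarrow> (\<forall>i j. a \<le> i \<and> i < j \<and> j \<le> b \<longrightarrow> minor2 i j \<in> I)"
    unfolding minors_ideal_def Idl_poly_ring_subset_iff[OF B] by blast
qed

section \<open>Toric ideals of proportional columns\<close>

text \<open>
  Let \<open>r\<close> assign to every index the name of its class. The weight of a monomial is the exponent vector
  of its image under \<open>x\<^sub>i \<mapsto> a\<^bsub>r i\<^esub> t\<^sub>i\<close>, \<open>y\<^sub>i \<mapsto> t\<^sub>i\<close>, where \<open>t\<^sub>i\<close> is the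
  variable with number \<open>2 i\<close> and \<open>a\<^sub>c\<close> the one with number \<open>2 c + 1\<close>. Using natural numbers as
  variables gives the monomials of the target a linear order, from which it follows that the target is
  an integral domain.
\<close>

definition toric_weight :: "nat \<Rightarrow> (nat \<Rightarrow> nat) \<Rightarrow> (var \<Rightarrow>\<^sub>0 nat) \<Rightarrow> (nat \<Rightarrow>\<^sub>0 nat)" where
  "toric_weight n r m = (\<Sum>i\<in>{1..n}.
      Poly_Mapping.single (2 * i)
        (Poly_Mapping.lookup m (XVar i) + Poly_Mapping.lookup m (YVar i))
    + Poly_Mapping.single (2 * r i + 1) (Poly_Mapping.lookup m (XVar i)))"

text \<open>
  The homomorphism just described, composed with setting \<open>x\<^sub>s = y\<^sub>s = 0\<close> for \<open>s \<in> S\<close>. The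
  image of the generic \<open>2 \<times> n\<close> matrix has zero columns in \<open>S\<close>, and its other columns
  \<open>(a\<^sub>c t\<^sub>i, t\<^sub>i)\<close> are proportional within each class.
\<close>

definition toric_map :: "nat \<Rightarrow> nat set \<Rightarrow> (nat \<Rightarrow> nat) \<Rightarrow> 'k::field mpoly \<Rightarrow> (nat \<Rightarrow>\<^sub>0 nat) \<Rightarrow>\<^sub>0 'k" where
  "toric_map n S r = linear_ext (\<lambda>m.
     if Poly_Mapping.keys m \<inter> (XVar ` S \<union> YVar ` S) = {}
     then Poly_Mapping.single (toric_weight n r m) 1 else 0)"

definition toric_ideal :: "nat \<Rightarrow> nat set \<Rightarrow> (nat \<Rightarrow> nat) \<Rightarrow> 'k::field mpoly set" where
  "toric_ideal n S r = {p \<in> carrier (poly_ring n). toric_map n S r p = 0}"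

lemma toric_weight_add: "toric_weight n r (a + b) = toric_weight n r a + toric_weight n r b"
  by (simp add: toric_weight_def lookup_add single_add sum.distrib algebra_simps)

text \<open>
  The even coordinates of the weight are the exponents of the \<open>t\<^sub>i\<close>. The odd ones, treated next, are
  those of the \<open>a\<^sub>c\<close>; the two families do not interfere.
\<close>

lemma toric_weight_vertex:
  assumes "i \<in> {1..n}"
  shows "Poly_Mapping.lookup (toric_weight n r m) (2 * i)
    = Poly_Mapping.lookup m (XVar i) + Poly_Mapping.lookup m (YVar i)"
proof -
  have "Poly_Mapping.lookup (toric_weight n r m) (2 * i)
    = (\<Sum>k\<in>{1..n}. if k = i then Poly_Mapping.lookup m (XVar k) + Poly_Mapping.lookup m (YVar k) else 0)"
    unfolding toric_weight_def lookup_sum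
  proof (rule sum.cong)
    fix k
    have "2 * i \<noteq> Suc (2 * r k)" by presburger
    then show "Poly_Mapping.lookup (Poly_Mapping.single (2 * k)
         (Poly_Mapping.lookup m (XVar k) + Poly_Mapping.lookup m (YVar k)) +
        Poly_Mapping.single (2 * r k + 1) (Poly_Mapping.lookup m (XVar k))) (2 * i) =
        (if k = i then Poly_Mapping.lookup m (XVar k) + Poly_Mapping.lookup m (YVar k) else 0)"
      by (auto simp: lookup_add lookup_single when_def)
  qed simp
  then show ?thesis
    using assms by (simp add: sum.delta)
qed

lemma toric_weight_class:
  "Poly_Mapping.lookup (toric_weight n r m) (2 * c + 1)
    = (\<Sum>i | i \<in> {1..n} \<and> r i = c. Poly_Mapping.lookup m (XVar i))"
proof -
  have "Poly_Mapping.lookup (toric_weight n r m) (2 * c + 1)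
    = (\<Sum>i\<in>{1..n}. if r i = c then Poly_Mapping.lookup m (XVar i) else 0)"
    unfolding toric_weight_def lookup_sum
  proof (rule sum.cong)
    fix k
    have "2 * k \<noteq> Suc (2 * c)" by presburger
    then show "Poly_Mapping.lookup (Poly_Mapping.single (2 * k)
         (Poly_Mapping.lookup m (XVar k) + Poly_Mapping.lookup m (YVar k)) +
        Poly_Mapping.single (2 * r k + 1) (Poly_Mapping.lookup m (XVar k))) (2 * c + 1) =
        (if r k = c then Poly_Mapping.lookup m (XVar k) else 0)"
      by (auto simp: lookup_add lookup_single when_def)
  qed simp
  then show ?thesis
    using sum.inter_filter[of "{1..n}" "\<lambda>i. Poly_Mapping.lookup m (XVar i)" "\<lambda>i. r i = c"] by simp
qed

lemma toric_weight_swap_iff: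
  assumes "i \<in> {1..n}" "j \<in> {1..n}"
  shows "toric_weight n r (Poly_Mapping.single (XVar i) 1 + Poly_Mapping.single (YVar j) 1)
      = toric_weight n r (Poly_Mapping.single (XVar j) 1 + Poly_Mapping.single (YVar i) 1)
    \<longleftrightarrow> r i = r j"
proof -
  define w where "w i j = toric_weight n r (Poly_Mapping.single (XVar i) 1 + Poly_Mapping.single (YVar j) 1)" for i j
  have "w i j = Poly_Mapping.single (2 * i) 1 + Poly_Mapping.single (2 * r i + 1) 1 + Poly_Mapping.single (2 * j) 1"
    if "i \<in> {1..n}" "j \<in> {1..n}" for i j
  proof -
    have X: "toric_weight n r (Poly_Mapping.single (XVar i) 1)
        = (\<Sum>k\<in>{1..n}. if k = i then Poly_Mapping.single (2 * k) 1 + Poly_Mapping.single (2 * r k + 1) 1 else 0)"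
      unfolding toric_weight_def by (rule sum.cong) (auto simp: lookup_single when_def)
    have Y: "toric_weight n r (Poly_Mapping.single (YVar j) 1)
        = (\<Sum>k\<in>{1..n}. if k = j then Poly_Mapping.single (2 * k) 1 else 0)"
      unfolding toric_weight_def by (rule sum.cong) (auto simp: lookup_single when_def)
    show ?thesis
      using that unfolding w_def toric_weight_add X Y by simp
  qed
  then have w: "w i j = Poly_Mapping.single (2 * i) 1 + Poly_Mapping.single (2 * r i + 1) 1 + Poly_Mapping.single (2 * j) 1"
    "w j i = Poly_Mapping.single (2 * j) 1 + Poly_Mapping.single (2 * r j + 1) 1 + Poly_Mapping.single (2 * i) 1"
    using assms by blast+
  have "w i j = w j i \<longleftrightarrow> r i = r j"
  proof
    show "w i j = w j i" if "r i = r j"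
      using that unfolding w by (simp add: ac_simps)
    assume "w i j = w j i"
    then have "Poly_Mapping.single (2 * r i + 1) (1::nat) = Poly_Mapping.single (2 * r j + 1) 1"
      unfolding w by (simp add: ac_simps)
    then have "2 * r i + 1 = 2 * r j + 1"
      by (simp only: single_1_eq_iff)
    then show "r i = r j" by simp
  qed
  then show ?thesis by (simp only: w_def)
qed

lemma toric_map_mult: "toric_map n S r (p * q) = toric_map n S r p * toric_map n S r q"
  unfolding toric_map_def
  by (rule linear_ext_mult) (auto simp: keys_add_nat toric_weight_add mult_single)

lemma toric_map_one [simp]: "toric_map n S r 1 = 1"
proof -
  have "toric_weight n r 0 = 0"
    by (simp add: toric_weight_def)
  moreover have "toric_map n S r (Poly_Mapping.single 0 1) = 1"
    unfolding toric_map_def linear_ext_single using calculation by simp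
  ultimately show ?thesis by simp
qed

lemma toric_map_indet_eq_0:
  "toric_map n S r (indet (XVar i)) = 0 \<longleftrightarrow> i \<in> S"
  "toric_map n S r (indet (YVar i)) = 0 \<longleftrightarrow> i \<in> S"
  by (auto simp: toric_map_def indet_def mult_single single_eq_0_iff)

text \<open>
  A minor of two surviving columns dies only if the columns lie in the same class: this is what later
  makes the components of the graph visible in the ideal.
\<close>

lemma toric_map_minor2_eq_0:
  assumes ij: "i \<in> {1..n}" "j \<in> {1..n}"
  shows "toric_map n S r (minor2 i j :: 'k::field mpoly) = 0 \<longleftrightarrow> i \<in> S \<or> j \<in> S \<or> r i = r j"
proof (cases "i \<in> S \<or> j \<in> S")
  case True
  then have "\<not> Poly_Mapping.keys (Poly_Mapping.single (XVar i) (1::nat) + Poly_Mapping.single (YVar j) 1)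
      \<inter> (XVar ` S \<union> YVar ` S) = {}"
    and "\<not> Poly_Mapping.keys (Poly_Mapping.single (XVar j) (1::nat) + Poly_Mapping.single (YVar i) 1)
      \<inter> (XVar ` S \<union> YVar ` S) = {}"
    by (auto simp: keys_add_nat)
  then show ?thesis
    using True unfolding toric_map_def minor2_eq_binomial linear_ext_diff linear_ext_single by auto
next
  case False
  let ?w = "\<lambda>i j. toric_weight n r (Poly_Mapping.single (XVar i) 1 + Poly_Mapping.single (YVar j) 1)"
  have "toric_map n S r (minor2 i j :: 'k mpoly) = Poly_Mapping.single (?w i j) 1 - Poly_Mapping.single (?w j i) 1"
    using False unfolding toric_map_def minor2_eq_binomial linear_ext_diff
    by (auto simp: mult_single keys_add_nat)
  then show ?thesis
    using False toric_weight_swap_iff[OF ij, of r] by (simp add: single_1_eq_iff)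
qed

lemma primeideal_toric_ideal: "primeideal (toric_ideal n S r) (poly_ring n :: 'k::field mpoly ring)"
proof (rule primeidealI)
  let ?R = "poly_ring n :: 'k mpoly ring" and ?T = "toric_ideal n S r :: 'k mpoly set"
  interpret cring ?R by (rule cring_poly_ring)
  have closed: "p + q \<in> carrier ?R" "p * q \<in> carrier ?R" if "p \<in> carrier ?R" "q \<in> carrier ?R" for p q
    using a_closed[OF that] m_closed[OF that] by simp_all
  have add: "toric_map n S r (p + q) = toric_map n S r p + toric_map n S r q" for p q :: "'k mpoly"
    by (simp add: toric_map_def linear_ext_add)
  have uminus: "toric_map n S r (- p) = - toric_map n S r p" for p :: "'k mpoly"
    by (simp add: toric_map_def linear_ext_uminus)
  have zero: "toric_map n S r 0 = (0 :: _ \<Rightarrow>\<^sub>0 'k)"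
    by (simp add: toric_map_def)
  show "ideal ?T ?R"
  proof (rule idealI)
    show "ring ?R" by (rule ring_poly_ring)
    show "subgroup ?T (add_monoid ?R)"
    proof (rule add.subgroupI)
      show "?T \<noteq> {}"
        using zero zero_closed by (auto simp: toric_ideal_def)
      show "\<ominus>\<^bsub>?R\<^esub> p \<in> ?T" if "p \<in> ?T" for p
      proof -
        have "\<ominus>\<^bsub>?R\<^esub> p = - p"
          using that by (intro minus_equality) (auto simp: toric_ideal_def poly_ring_uminus)
        then show ?thesis
          using that by (simp add: toric_ideal_def uminus poly_ring_uminus)
      qed
    qed (auto simp: toric_ideal_def add closed)
  qed (auto simp: toric_ideal_def toric_map_mult closed)
  show "cring ?R" by (rule cring_poly_ring)
  show "carrier ?R \<noteq> ?T"
  proof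
    assume "carrier ?R = ?T"
    then have "1 \<in> ?T" using one_closed by simp
    then show False by (simp add: toric_ideal_def)
  qed
  show "p \<in> ?T \<or> q \<in> ?T"
    if "p \<in> carrier ?R" "q \<in> carrier ?R" "p \<otimes>\<^bsub>?R\<^esub> q \<in> ?T" for p q
    using that by (auto simp: toric_ideal_def toric_map_mult)
qed

text \<open>
  The fibres of the weight are connected by the moves \<open>x\<^sub>i y\<^sub>j \<leftrightarrow> x\<^sub>j y\<^sub>i\<close> inside a class, and each move changes
  a monomial by a multiple of a minor. If two monomials of equal weight differ, then the first has an
  \<open>x\<close>-exponent that is too large at some \<open>i\<close>; equality of the class sums gives a \<open>j\<close> in the class of \<open>i\<close>
  where it is too small, and equality of the column degrees guarantees that \<open>y\<^sub>j\<close> is available for the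
  move. Each move decreases the total excess of the \<open>x\<close>-exponents.
\<close>

lemma binomial_in_ideal:
  assumes I: "ideal I (poly_ring n :: 'k::field mpoly ring)"
    and minors: "\<And>i j. i \<in> {1..n} - S \<Longrightarrow> j \<in> {1..n} - S \<Longrightarrow> r i = r j \<Longrightarrow> minor2 i j \<in> I"
    and "Poly_Mapping.keys m \<subseteq> XVar ` ({1..n} - S) \<union> YVar ` ({1..n} - S)"
    and m': "Poly_Mapping.keys m' \<subseteq> XVar ` ({1..n} - S) \<union> YVar ` ({1..n} - S)"
    and "toric_weight n r m = toric_weight n r m'"
  shows "Poly_Mapping.single m 1 - Poly_Mapping.single m' 1 \<in> I"
  using assms(3,5)
proof (induction "\<Sum>i\<in>{1..n}. Poly_Mapping.lookup m (XVar i) - Poly_Mapping.lookup m' (XVar i)"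
    arbitrary: m rule: less_induct)
  case less
  let ?l = Poly_Mapping.lookup and ?s = "\<lambda>v. Poly_Mapping.single v (1::nat)"
  have total: "?l m (XVar i) + ?l m (YVar i) = ?l m' (XVar i) + ?l m' (YVar i)" if "i \<in> {1..n}" for i
    using toric_weight_vertex[OF that, of r] less.prems(2) by metis
  have classes: "(\<Sum>i | i \<in> {1..n} \<and> r i = c. ?l m (XVar i)) = (\<Sum>i | i \<in> {1..n} \<and> r i = c. ?l m' (XVar i))" for c
    using toric_weight_class[of n r _ c] less.prems(2) by metis
  have outside: "?l m v = 0 \<and> ?l m' v = 0" if "v \<notin> XVar ` ({1..n} - S) \<union> YVar ` ({1..n} - S)" for v
    using that less.prems(1) m' by (auto simp: in_keys_iff)
  show ?case
  proof (cases "\<forall>i\<in>{1..n}. ?l m (XVar i) \<le> ?l m' (XVar i)")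
    case True
    have X: "?l m (XVar i) = ?l m' (XVar i)" if i: "i \<in> {1..n}" for i
    proof (rule ccontr)
      assume "?l m (XVar i) \<noteq> ?l m' (XVar i)"
      then have "(\<Sum>k | k \<in> {1..n} \<and> r k = r i. ?l m (XVar k)) < (\<Sum>k | k \<in> {1..n} \<and> r k = r i. ?l m' (XVar k))"
        using True i by (intro sum_strict_mono_ex1) (auto intro!: bexI[of _ i] simp: le_neq_implies_less)
      then show False using classes[of "r i"] by simp
    qed
    have "m = m'"
    proof (rule poly_mapping_eqI)
      fix v
      show "?l m v = ?l m' v"
      proof (cases "v \<in> XVar ` ({1..n} - S) \<union> YVar ` ({1..n} - S)")
        case True
        then obtain i where i: "i \<in> {1..n}" "v = XVar i \<or> v = YVar i" by auto
        show ?thesis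
          using X[OF i(1)] total[OF i(1)] i(2) by auto
      qed (use outside in auto)
    qed
    then show ?thesis
      using ideal_poly_ring_zero[OF I] by simp
  next
    case False
    then obtain i where i: "i \<in> {1..n}" "?l m' (XVar i) < ?l m (XVar i)"
      by (auto simp: not_le)
    have "\<exists>j\<in>{1..n}. r j = r i \<and> ?l m (XVar j) < ?l m' (XVar j)"
    proof (rule ccontr)
      assume "\<not> ?thesis"
      then have "(\<Sum>k | k \<in> {1..n} \<and> r k = r i. ?l m' (XVar k)) < (\<Sum>k | k \<in> {1..n} \<and> r k = r i. ?l m (XVar k))"
        using i by (intro sum_strict_mono_ex1) (auto intro!: bexI[of _ i] simp: not_less)
      then show False using classes[of "r i"] by simp
    qed
    then obtain j where j: "j \<in> {1..n}" "r j = r i" "?l m (XVar j) < ?l m' (XVar j)"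
      by blast
    have "i \<noteq> j" using i j by auto
    have Yj: "0 < ?l m (YVar j)"
      using total[OF j(1)] j(3) by simp
    have notS: "i \<notin> S" "j \<notin> S"
      using outside[of "XVar i"] outside[of "XVar j"] i j by fastforce+
    define e where "e = m - ?s (XVar i) - ?s (YVar j)"
    define m1 where "m1 = e + ?s (XVar j) + ?s (YVar i)"
    have m: "m = e + ?s (XVar i) + ?s (YVar j)"
      unfolding e_def using i Yj
      by (intro poly_mapping_eqI) (auto simp: lookup_add lookup_minus lookup_single when_def)
    have keys_e: "Poly_Mapping.keys e \<subseteq> Poly_Mapping.keys m"
      unfolding m keys_add_nat by blast
    have eR: "Poly_Mapping.single e (1::'k) \<in> carrier (poly_ring n)"
      using keys_e less.prems(1) by (intro single_in_poly_ring) blast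
    have keys1: "Poly_Mapping.keys m1 \<subseteq> XVar ` ({1..n} - S) \<union> YVar ` ({1..n} - S)"
      unfolding m1_def keys_add_nat using keys_e less.prems(1) i j notS by auto
    have "(Poly_Mapping.single m 1 - Poly_Mapping.single m1 1 :: 'k mpoly)
        = Poly_Mapping.single e 1 * minor2 i j"
      unfolding m m1_def minor2_eq_binomial by (simp add: right_diff_distrib mult_single add.assoc)
    then have step: "Poly_Mapping.single m 1 - Poly_Mapping.single m1 1 \<in> I"
      using ideal_poly_ring_mult[OF I eR minors[of i j]] i j notS by simp
    have "toric_weight n r (?s (XVar i) + ?s (YVar j)) = toric_weight n r (?s (XVar j) + ?s (YVar i))"
      using toric_weight_swap_iff i j by simp
    then have weight1: "toric_weight n r m1 = toric_weight n r m'"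
      unfolding less.prems(2)[symmetric] m m1_def by (simp add: toric_weight_add add.assoc)
    have "(\<Sum>k\<in>{1..n}. ?l m1 (XVar k) - ?l m' (XVar k)) < (\<Sum>k\<in>{1..n}. ?l m (XVar k) - ?l m' (XVar k))"
    proof (rule sum_strict_mono_ex1)
      have eX: "?l m (XVar k) = ?l e (XVar k) + (if k = i then 1 else 0)"
        "?l m1 (XVar k) = ?l e (XVar k) + (if k = j then 1 else 0)" for k
        unfolding m m1_def by (auto simp: lookup_add lookup_single when_def)
      show "\<forall>k\<in>{1..n}. ?l m1 (XVar k) - ?l m' (XVar k) \<le> ?l m (XVar k) - ?l m' (XVar k)"
        using j(3) \<open>i \<noteq> j\<close> by (auto simp: eX)
      show "\<exists>k\<in>{1..n}. ?l m1 (XVar k) - ?l m' (XVar k) < ?l m (XVar k) - ?l m' (XVar k)"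
        using i \<open>i \<noteq> j\<close> by (intro bexI[of _ i]) (auto simp: eX)
    qed simp
    then have "Poly_Mapping.single m1 1 - Poly_Mapping.single m' 1 \<in> I"
      using keys1 weight1 by (rule less.hyps)
    from ideal_poly_ring_add[OF I step this] show ?thesis by simp
  qed
qed

text \<open>
  Together with the evident elements of the kernel this says that the toric ideal is generated by the
  variables of \<open>S\<close> and the minors inside the classes. Modulo these generators each monomial is zero or
  equals a representative depending only on its weight, so that \<open>p\<close> is congruent to the image of
  \<open>toric_map n S r p\<close> under the linear map \<open>F\<close> that sends a weight to its representative.
\<close>

lemma toric_ideal_subset:
  assumes I: "ideal I (poly_ring n :: 'k::field mpoly ring)"
    and vars: "\<And>i. i \<in> S \<Longrightarrow> indet (XVar i) \<in> I \<and> indet (YVar i) \<in> I"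
    and minors: "\<And>i j. i \<in> {1..n} - S \<Longrightarrow> j \<in> {1..n} - S \<Longrightarrow> r i = r j \<Longrightarrow> minor2 i j \<in> I"
  shows "toric_ideal n S r \<subseteq> I"
proof
  fix p :: "'k mpoly" assume p: "p \<in> toric_ideal n S r"
  let ?V = "XVar ` ({1..n} - S) \<union> YVar ` ({1..n} - S)"
  define rep where "rep d = (SOME m. Poly_Mapping.keys m \<subseteq> ?V \<and> toric_weight n r m = d)" for d
  define F :: "((nat \<Rightarrow>\<^sub>0 nat) \<Rightarrow>\<^sub>0 'k) \<Rightarrow> 'k mpoly"
    where "F = linear_ext (\<lambda>d. Poly_Mapping.single (rep d) 1)"
  let ?s = "\<lambda>m. Poly_Mapping.single m (Poly_Mapping.lookup p m)"
  have monomial: "?s m - F (toric_map n S r (?s m)) \<in> I" if "m \<in> Poly_Mapping.keys p" for m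
  proof (cases "Poly_Mapping.keys m \<inter> (XVar ` S \<union> YVar ` S) = {}")
    case False
    then obtain v where v: "v \<in> Poly_Mapping.keys m" "v \<in> XVar ` S \<union> YVar ` S" by blast
    define e where "e = m - Poly_Mapping.single v 1"
    have m: "m = e + Poly_Mapping.single v 1"
      unfolding e_def using v(1)
      by (intro poly_mapping_eqI) (auto simp: lookup_add lookup_minus lookup_single when_def in_keys_iff)
    have "Poly_Mapping.keys e \<subseteq> Poly_Mapping.keys m"
      unfolding m keys_add_nat by blast
    also have "\<dots> \<subseteq> XVar ` {1..n} \<union> YVar ` {1..n}"
      using p that by (simp add: toric_ideal_def mem_poly_ring)
    finally have "Poly_Mapping.single e (Poly_Mapping.lookup p m) \<in> carrier (poly_ring n)"
      by (rule single_in_poly_ring)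
    moreover have "?s m = Poly_Mapping.single e (Poly_Mapping.lookup p m) * indet v"
      by (subst m) (simp add: indet_def mult_single)
    moreover have "indet v \<in> I"
      using v(2) vars by auto
    ultimately have "?s m \<in> I"
      using ideal_poly_ring_mult[OF I] by metis
    moreover have "toric_map n S r (?s m) = 0"
      unfolding toric_map_def linear_ext_single using False by simp
    ultimately show ?thesis by (simp add: F_def)
  next
    case True
    have m: "Poly_Mapping.keys m \<subseteq> ?V"
    proof
      fix v assume v: "v \<in> Poly_Mapping.keys m"
      then have "v \<in> XVar ` {1..n} \<union> YVar ` {1..n}"
        using p that by (simp add: toric_ideal_def mem_poly_ring subset_iff)
      moreover have "v \<notin> XVar ` S \<union> YVar ` S"
        using v True by blast
      ultimately show "v \<in> ?V" by blast
    qed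
    then have rep: "Poly_Mapping.keys (rep (toric_weight n r m)) \<subseteq> ?V
        \<and> toric_weight n r (rep (toric_weight n r m)) = toric_weight n r m"
      using someI[of "\<lambda>k. Poly_Mapping.keys k \<subseteq> ?V \<and> toric_weight n r k = toric_weight n r m" m]
      unfolding rep_def by blast
    have "F (toric_map n S r (?s m)) = Poly_Mapping.single (rep (toric_weight n r m)) (Poly_Mapping.lookup p m)"
      unfolding toric_map_def linear_ext_single F_def using True by (simp add: mult_single)
    then have "?s m - F (toric_map n S r (?s m))
        = Poly_Mapping.single 0 (Poly_Mapping.lookup p m)
          * (Poly_Mapping.single m 1 - Poly_Mapping.single (rep (toric_weight n r m)) 1)"
      by (simp add: right_diff_distrib mult_single)
    moreover have "Poly_Mapping.single m 1 - Poly_Mapping.single (rep (toric_weight n r m)) 1 \<in> I"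
      using rep m by (intro binomial_in_ideal[OF I minors, where S = S and r = r]) auto
    ultimately show ?thesis
      using ideal_poly_ring_mult[OF I single_in_poly_ring[of 0 n]] by simp
  qed
  have "p - F (toric_map n S r p)
      = (\<Sum>m\<in>Poly_Mapping.keys p. ?s m - F (toric_map n S r (?s m)))"
    unfolding sum_subtractf F_def toric_map_def linear_ext_sum[symmetric]
    by (simp only: sum_single_lookup)
  also have "\<dots> \<in> I"
    using monomial by (intro ideal_poly_ring_sum[OF I])
  finally show "p \<in> I"
    using p by (simp add: toric_ideal_def F_def)
qed

section \<open>Components after deleting vertices\<close>

definition component_of :: "'v pair_pre_digraph \<Rightarrow> 'v set \<Rightarrow> 'v \<Rightarrow> 'v set" where
  "component_of H S i = {j. i \<rightarrow>\<^sup>*\<^bsub>with_proj H \<restriction> (pverts H - S)\<^esub> j}"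

context pair_sym_digraph
begin

abbreviation minus_verts :: "'a set \<Rightarrow> ('a, 'a \<times> 'a) pre_digraph" where
  "minus_verts S \<equiv> with_proj G \<restriction> (pverts G - S)"

lemma minus_verts_arcs: "arcs_ends (minus_verts S) = {(i, j) \<in> parcs G. i \<notin> S \<and> j \<notin> S}"
  using wellformed' by (fastforce simp: arcs_ends_conv)

lemma wf_minus_verts: "wf_digraph (minus_verts S)"
  by unfold_locales auto

lemma symmetric_minus_verts: "symmetric (minus_verts S)"
  using pair_sym_arcs unfolding symmetric_def minus_verts_arcs by (auto simp: sym_def)

lemma component_of_eq_iff:
  assumes "i \<in> pverts G - S" "j \<in> pverts G - S"
  shows "component_of G S i = component_of G S j \<longleftrightarrow> j \<in> component_of G S i"
proof -
  interpret D: wf_digraph "minus_verts S" by (rule wf_minus_verts)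
  have "j \<in> component_of G S j"
    using assms by (auto simp: component_of_def)
  moreover have "i \<in> component_of G S j" if "j \<in> component_of G S i"
    using that symmetric_reachable[OF symmetric_minus_verts] by (auto simp: component_of_def)
  ultimately show ?thesis
    by (auto simp: component_of_def intro: D.reachable_trans)
qed

lemma component_of_self: "i \<in> pverts G - S \<Longrightarrow> i \<in> component_of G S i"
  using wf_digraph.reachable_refl[OF wf_minus_verts] by (simp add: component_of_def)

lemma component_of_subset: "component_of G S i \<subseteq> pverts G - S"
  by (auto simp: component_of_def elim: reachable_in_vertsE)

lemma component_of_adj:
  assumes "(i, j) \<in> parcs G" "i \<notin> S" "j \<notin> S"
  shows "j \<in> component_of G S i"
  using assms wf_digraph.reachable_adjI[OF wf_minus_verts, of i j S]
  by (auto simp: component_of_def minus_verts_arcs)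

text \<open>
  In a symmetric digraph mutual reachability is just reachability.
\<close>

lemma components_minus_eq: "components_minus G S = component_of G S ` (pverts G - S)"
proof -
  interpret D: wf_digraph "minus_verts S" by (rule wf_minus_verts)
  have "D.scc_of i = component_of G S i" for i
    using symmetric_reachable[OF symmetric_minus_verts] by (auto simp: component_of_def D.scc_of_def)
  then show ?thesis
    unfolding components_minus_def D.sccs_verts_conv_scc_of by simp
qed

end

lemma pair_sym_digraph_relabel:
  assumes "pair_graph G"
  shows "pair_sym_digraph (relabel l G)"
proof -
  interpret pair_graph G by fact
  show ?thesis
  proof unfold_locales
    show "symmetric (with_proj (relabel l G))"
      using pair_sym_arcs by (fastforce simp: symmetric_def relabel_def sym_def)
  qed (auto simp: relabel_def wellformed')
qed

lemma pverts_relabel: "labeling l G \<Longrightarrow> pverts (relabel l G) = {1..card (pverts G)}"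
  by (simp add: labeling_def relabel_def bij_betw_def)

locale numbered_graph = pair_sym_digraph H for H :: "nat pair_pre_digraph" +
  fixes n :: nat
  assumes pverts_eq: "pverts H = {1..n}"
begin

lemma arcs_subset: "parcs H \<subseteq> {1..n} \<times> {1..n}"
  using wellformed' pverts_eq by auto

lemma finite_component: "finite (component_of H S i)"
  by (rule finite_subset[OF component_of_subset]) (simp add: pverts_eq)

lemma component_bounds:
  assumes "j \<in> component_of H S i"
  shows "Min (component_of H S i) \<in> component_of H S i" "Min (component_of H S i) \<le> j"
    and "Max (component_of H S i) \<in> component_of H S i" "j \<le> Max (component_of H S i)"
proof -
  have "component_of H S i \<noteq> {}" using assms by blast
  then show "Min (component_of H S i) \<in> component_of H S i" "Max (component_of H S i) \<in> component_of H S i"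
    by (rule Min_in[OF finite_component] Max_in[OF finite_component])+
qed (use assms finite_component in auto)

text \<open>
  The smallest vertex serves as the name of a component.
\<close>

lemma Min_component_eq_iff:
  assumes "i \<in> {1..n} - S" "j \<in> {1..n} - S"
  shows "Min (component_of H S i) = Min (component_of H S j) \<longleftrightarrow> j \<in> component_of H S i"
proof
  assume eq: "Min (component_of H S i) = Min (component_of H S j)" (is "?k = _")
  have ij: "i \<in> pverts H - S" "j \<in> pverts H - S" using assms by (simp_all add: pverts_eq)
  have k: "?k \<in> component_of H S i" "?k \<in> component_of H S j"
    using component_bounds(1) component_of_self[OF ij(1)] component_of_self[OF ij(2)] eq by metis+
  then have "?k \<in> pverts H - S" using component_of_subset by blast
  then have "component_of H S i = component_of H S j"
    using k component_of_eq_iff[OF ij(1)] component_of_eq_iff[OF ij(2)] by metis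
  then show "j \<in> component_of H S i"
    using component_of_eq_iff[OF ij] by simp
next
  assume "j \<in> component_of H S i"
  then show "Min (component_of H S i) = Min (component_of H S j)"
    using component_of_eq_iff[of i S j] assms by (simp add: pverts_eq)
qed

section \<open>The ideals attached to vertex sets\<close>

text \<open>
  Each element \<open>i\<close> of a component \<open>C\<close> has \<open>C\<close> as its component. Hence the minors of \<open>C\<close> with first column
  \<open>i\<close>, for \<open>i\<close> ranging over all vertices outside \<open>S\<close>, exhaust the minors inside the components.
\<close>

lemma
  assumes S: "S \<subseteq> {1..n}"
  shows ideal_P_ideal: "ideal (P_ideal n H S) (poly_ring n :: 'k::field mpoly ring)"
    and P_ideal_subset_iff: "ideal I (poly_ring n) \<Longrightarrow> (P_ideal n H S :: 'k mpoly set) \<subseteq> I \<longleftrightarrow>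
      (\<forall>i\<in>S. indet (XVar i) \<in> I \<and> indet (YVar i) \<in> I) \<and>
      (\<forall>i\<in>{1..n} - S. \<forall>j\<in>component_of H S i. minor2 i j \<in> I)"
proof -
  have arcs: "parcs (complete_on (component_of H S i)) \<subseteq> {1..n} \<times> {1..n}" for i
    using component_of_subset[of S i] by (auto simp: complete_on_def pverts_eq)
  let ?F = "insert (var_ideal n S)
      ((\<lambda>C. binomial_edge_ideal n (complete_on C)) ` components_minus H S) :: 'k mpoly set set"
  have ideals: "ideal J (poly_ring n)" if "J \<in> ?F" for J
    using that ideal_var_ideal[OF S] ideal_binomial_edge_ideal[OF arcs]
    unfolding components_minus_eq by blast
  show "ideal (P_ideal n H S) (poly_ring n :: 'k mpoly ring)"
    unfolding P_ideal_def by (rule ideal_ideal_sum[OF ideals])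
  assume I: "ideal I (poly_ring n :: 'k mpoly ring)"
  have sum_iff: "ideal_sum (poly_ring n) ?F \<subseteq> I \<longleftrightarrow> (\<forall>J\<in>?F. J \<subseteq> I)"
    using ideals I by (rule ideal_sum_subset_iff)
  have "binomial_edge_ideal n (complete_on (component_of H S i)) \<subseteq> I \<longleftrightarrow>
      (\<forall>j\<in>component_of H S i. \<forall>k\<in>component_of H S i. minor2 j k \<in> I)" for i
    unfolding binomial_edge_ideal_subset_iff[OF arcs I]
    using ideal_poly_ring_zero[OF I] by (force simp: complete_on_def minor2_def)
  moreover have "(\<forall>i\<in>{1..n} - S. \<forall>j\<in>component_of H S i. \<forall>k\<in>component_of H S i. minor2 j k \<in> I) \<longleftrightarrow>
      (\<forall>i\<in>{1..n} - S. \<forall>j\<in>component_of H S i. minor2 i j \<in> I)"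
    using component_of_self component_of_eq_iff component_of_subset pverts_eq by (metis subsetD)
  ultimately show "(P_ideal n H S :: 'k mpoly set) \<subseteq> I \<longleftrightarrow>
      (\<forall>i\<in>S. indet (XVar i) \<in> I \<and> indet (YVar i) \<in> I) \<and>
      (\<forall>i\<in>{1..n} - S. \<forall>j\<in>component_of H S i. minor2 i j \<in> I)"
    unfolding P_ideal_def sum_iff
    by (simp add: components_minus_eq var_ideal_subset_iff[OF S I] pverts_eq)
qed

lemma
  assumes S: "S \<subseteq> {1..n}"
  shows ideal_P_bar_ideal: "ideal (P_bar_ideal n H S) (poly_ring n :: 'k::field mpoly ring)"
    and P_bar_ideal_subset_iff: "ideal I (poly_ring n) \<Longrightarrow> (P_bar_ideal n H S :: 'k mpoly set) \<subseteq> I \<longleftrightarrow>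
      (\<forall>i\<in>S. indet (XVar i) \<in> I \<and> indet (YVar i) \<in> I) \<and>
      (\<forall>C\<in>components_minus H S. \<forall>i j. Min C \<le> i \<and> i < j \<and> j \<le> Max C \<longrightarrow> minor2 i j \<in> I)"
proof -
  have bounds: "1 \<le> Min C" "Max C \<le> n" if "C \<in> components_minus H S" for C
    using that component_bounds(1,3)[OF component_of_self] component_of_subset
    unfolding components_minus_eq pverts_eq by fastforce+
  let ?F = "insert (var_ideal n S)
      ((\<lambda>C. minors_ideal n (Min C) (Max C)) ` components_minus H S) :: 'k mpoly set set"
  have ideals: "ideal J (poly_ring n)" if "J \<in> ?F" for J
    using that ideal_var_ideal[OF S] ideal_minors_ideal[OF bounds] by blast
  show "ideal (P_bar_ideal n H S) (poly_ring n :: 'k mpoly ring)"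
    unfolding P_bar_ideal_def by (rule ideal_ideal_sum[OF ideals])
  assume I: "ideal I (poly_ring n :: 'k mpoly ring)"
  have sum_iff: "ideal_sum (poly_ring n) ?F \<subseteq> I \<longleftrightarrow> (\<forall>J\<in>?F. J \<subseteq> I)"
    using ideals I by (rule ideal_sum_subset_iff)
  show "(P_bar_ideal n H S :: 'k mpoly set) \<subseteq> I \<longleftrightarrow>
      (\<forall>i\<in>S. indet (XVar i) \<in> I \<and> indet (YVar i) \<in> I) \<and>
      (\<forall>C\<in>components_minus H S. \<forall>i j. Min C \<le> i \<and> i < j \<and> j \<le> Max C \<longrightarrow> minor2 i j \<in> I)"
    unfolding P_bar_ideal_def sum_iff
    by (simp add: var_ideal_subset_iff[OF S I] minors_ideal_subset_iff[OF bounds I])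
qed

text \<open>
  The key description of \<open>P\<^sub>S\<close>: it gives primality over every field and, by evaluating \<open>toric_map\<close>,
  membership criteria for variables and minors.
\<close>

lemma P_ideal_eq_toric_ideal:
  assumes S: "S \<subseteq> {1..n}"
  shows "(P_ideal n H S :: 'k::field mpoly set) = toric_ideal n S (\<lambda>i. Min (component_of H S i))"
    (is "?P = ?T")
proof (rule antisym)
  have T: "ideal ?T (poly_ring n)"
    using primeideal_toric_ideal by (rule primeideal.axioms(1))
  show "?P \<subseteq> ?T"
    unfolding P_ideal_subset_iff[OF S T]
  proof (intro conjI ballI)
    fix i j assume ij: "i \<in> {1..n} - S" "j \<in> component_of H S i"
    then have "j \<in> {1..n} - S"
      using component_of_subset pverts_eq by blast
    then show "minor2 i j \<in> ?T"
      using ij Min_component_eq_iff[of i S j]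
      by (simp add: toric_ideal_def toric_map_minor2_eq_0 minor2_in_poly_ring)
  qed (use S in \<open>auto simp: toric_ideal_def toric_map_indet_eq_0 intro!: indet_in_poly_ring\<close>)
  have P: "ideal ?P (poly_ring n)"
    by (rule ideal_P_ideal[OF S])
  \<comment> \<open>Reflexivity, read through \<open>P_ideal_subset_iff\<close>, says that the generators lie in the ideal.\<close>
  have "?P \<subseteq> ?P" ..
  note gens = this[unfolded P_ideal_subset_iff[OF S P]]
  show "?T \<subseteq> ?P"
    using gens Min_component_eq_iff by (intro toric_ideal_subset[OF P]) blast+
qed

lemma indet_in_P_ideal_iff:
  assumes "S \<subseteq> {1..n}" "i \<in> {1..n}"
  shows "indet (XVar i) \<in> (P_ideal n H S :: 'k::field mpoly set) \<longleftrightarrow> i \<in> S"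
  using assms indet_in_poly_ring
  by (auto simp: P_ideal_eq_toric_ideal toric_ideal_def toric_map_indet_eq_0)

lemma minor2_in_P_ideal_iff:
  assumes "S \<subseteq> {1..n}" "i \<in> {1..n}" "j \<in> {1..n}"
  shows "minor2 i j \<in> (P_ideal n H S :: 'k::field mpoly set) \<longleftrightarrow>
    i \<in> S \<or> j \<in> S \<or> j \<in> component_of H S i"
  using assms minor2_in_poly_ring[OF assms(2,3)] Min_component_eq_iff[of i S j]
  by (auto simp: P_ideal_eq_toric_ideal toric_ideal_def toric_map_minor2_eq_0)

text \<open>
  The minor of two columns lies in \<open>P\<^sub>S\<close> if and only if one of the columns is in \<open>S\<close> or both are in the
  same component. If all minors of the interval spanned by \<open>C\<close> lie in \<open>P\<^sub>S\<close>, then pairing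
  each column with \<open>Min C\<close> puts it in \<open>S\<close> or in \<open>C\<close>; the converse is immediate.
\<close>

lemma P_ideal_eq_P_bar_ideal_iff:
  assumes S: "S \<subseteq> {1..n}"
  shows "(P_ideal n H S :: 'k::field mpoly set) = P_bar_ideal n H S \<longleftrightarrow>
    (\<forall>C\<in>components_minus H S. {Min C..Max C} \<subseteq> C \<union> S)"
  (is "?P = ?Q \<longleftrightarrow> ?convex")
proof -
  note P = ideal_P_ideal[OF S, where 'k = 'k] P_ideal_subset_iff[OF S, where 'k = 'k]
    and Q = ideal_P_bar_ideal[OF S, where 'k = 'k] P_bar_ideal_subset_iff[OF S, where 'k = 'k]
  have "?Q \<subseteq> ?Q" ..
  note Q_gens = this[unfolded Q(2)[OF Q(1)]]
  have "?P \<subseteq> ?P" ..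
  note P_gens = this[unfolded P(2)[OF P(1)]]
  have "?P \<subseteq> ?Q"
    unfolding P(2)[OF Q(1)]
  proof (intro conjI ballI)
    fix i j assume i: "i \<in> {1..n} - S" and j: "j \<in> component_of H S i"
    let ?C = "component_of H S i"
    have C: "?C \<in> components_minus H S" and iC: "i \<in> ?C"
      using i component_of_self by (auto simp: components_minus_eq pverts_eq)
    have "Min ?C \<le> i" "i \<le> Max ?C" "Min ?C \<le> j" "j \<le> Max ?C"
      using component_bounds iC j by blast+
    then have "i < j \<Longrightarrow> minor2 i j \<in> ?Q" "j < i \<Longrightarrow> minor2 j i \<in> ?Q"
      using Q_gens C by blast+
    moreover have "minor2 i i \<in> ?Q"
      using ideal_poly_ring_zero[OF Q(1)] by (simp add: minor2_def)
    ultimately show "minor2 i j \<in> ?Q"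
      using ideal_poly_ring_uminus[OF Q(1)] minor2_swap by (metis nat_neq_iff)
  qed (use Q_gens in blast)+
  moreover have "?Q \<subseteq> ?P \<longleftrightarrow> ?convex"
  proof
    assume sub: "?Q \<subseteq> ?P"
    show ?convex
    proof (intro ballI subsetI)
      fix C v assume C: "C \<in> components_minus H S" and v: "v \<in> {Min C..Max C}"
      then obtain i where i: "i \<in> {1..n} - S" and Ci: "C = component_of H S i"
        by (auto simp: components_minus_eq pverts_eq)
      have iC: "i \<in> C"
        using component_of_self i by (simp add: Ci pverts_eq)
      have Min: "Min C \<in> C" and "Max C \<in> C"
        using component_bounds[of i S i] iC unfolding Ci by blast+
      then have range: "Min C \<in> {1..n} - S" "Max C \<in> {1..n}"
        using component_of_subset unfolding Ci pverts_eq by blast+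
      show "v \<in> C \<union> S"
      proof (cases "v = Min C")
        case False
        then have "minor2 (Min C) v \<in> ?Q"
          using Q_gens C v by auto
        then have "minor2 (Min C) v \<in> ?P" using sub by blast
        moreover have "v \<in> {1..n}" using range v by auto
        ultimately have "v \<in> S \<or> v \<in> component_of H S (Min C)"
          using minor2_in_P_ideal_iff[OF S, of "Min C" v] range by blast
        moreover have "component_of H S (Min C) = C"
          using component_of_eq_iff[of i S "Min C"] Min i range unfolding Ci pverts_eq by blast
        ultimately show ?thesis by blast
      qed (use Min in simp)
    qed
  next
    assume convex: ?convex
    show "?Q \<subseteq> ?P"
      unfolding Q(2)[OF P(1)]
    proof (intro conjI ballI allI impI)
      fix C i j assume C: "C \<in> components_minus H S" and ij: "Min C \<le> i \<and> i < j \<and> j \<le> Max C"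
      then obtain k where k: "k \<in> {1..n} - S" and Ck: "C = component_of H S k"
        by (auto simp: components_minus_eq pverts_eq)
      have "{Min C..Max C} \<subseteq> C \<union> S" "i \<in> {Min C..Max C}" "j \<in> {Min C..Max C}"
        using convex C ij by auto
      then have ij': "i \<in> C \<union> S" "j \<in> C \<union> S" by blast+
      moreover have "j \<in> component_of H S i" if "i \<in> C" "j \<in> C"
        using that k component_of_eq_iff component_of_subset unfolding Ck pverts_eq by blast
      moreover have "i \<in> {1..n}" "j \<in> {1..n}"
        using ij' S component_of_subset[of S k] unfolding Ck pverts_eq by blast+
      ultimately show "minor2 i j \<in> ?P"
        using minor2_in_P_ideal_iff[OF S] by blast
    qed (use P_gens in blast)+
  qed
  ultimately show ?thesis by blast
qed

section \<open>Minimal primes and weakly closed labelings\<close>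

lemma binomial_edge_ideal_subset_P_ideal:
  assumes S: "S \<subseteq> {1..n}"
  shows "(binomial_edge_ideal n H :: 'k::field mpoly set) \<subseteq> P_ideal n H S"
proof -
  have "minor2 i j \<in> (P_ideal n H S :: 'k mpoly set)" if "(i, j) \<in> parcs H" for i j
    using wellformed'[OF that] component_of_adj[OF that, of S] minor2_in_P_ideal_iff[OF S, of i j]
    unfolding pverts_eq by blast
  then show ?thesis
    using binomial_edge_ideal_subset_iff[OF arcs_subset ideal_P_ideal[OF S]] by blast
qed

text \<open>
  Take for \<open>U\<close> the columns that vanish modulo \<open>Q\<close>. Over the domain \<open>R/Q\<close> proportionality of nonzero
  columns is transitive, hence spreads from the edges of the graph to the components outside \<open>U\<close>.
\<close>

lemma prime_contains_P_ideal:
  assumes "primeideal Q (poly_ring n :: 'k::field mpoly ring)"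
    and "binomial_edge_ideal n H \<subseteq> Q"
  obtains U where "U \<subseteq> {1..n}" and "P_ideal n H U \<subseteq> Q"
proof
  interpret Q: primeideal Q "poly_ring n" by fact
  note I = Q.is_ideal
  define U where "U = {i \<in> {1..n}. indet (XVar i) \<in> Q \<and> indet (YVar i) \<in> Q}"
  show U: "U \<subseteq> {1..n}"
    by (auto simp: U_def)
  have edge: "minor2 x y \<in> Q" if "(x, y) \<in> parcs H" for x y
    using that assms(2) binomial_edge_ideal_subset_iff[OF arcs_subset I] by blast
  have "minor2 i j \<in> Q" if i: "i \<in> {1..n}" and "i \<rightarrow>\<^sup>*\<^bsub>minus_verts U\<^esub> j" for i j
    using that(2)
  proof (induction rule: wf_digraph.reachable_induct[OF wf_minus_verts, consumes 1])
    case 1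
    then show ?case using ideal_poly_ring_zero[OF I] by (simp add: minor2_def)
  next
    case (2 x y)
    have xy: "(x, y) \<in> parcs H" "x \<notin> U"
      using 2(2) by (auto simp: minus_verts_arcs)
    then have x: "x \<in> {1..n}" and y: "y \<in> {1..n}"
      using arcs_subset by auto
    \<comment> \<open>Both say that a \<open>3 \<times> 3\<close> determinant on the columns \<open>i, x, y\<close> with a repeated row vanishes.\<close>
    have "indet (XVar x) * minor2 i y = indet (XVar i) * minor2 x y + indet (XVar y) * minor2 i x"
      and "indet (YVar x) * minor2 i y = indet (YVar i) * minor2 x y + indet (YVar y) * minor2 i x"
      by (simp_all add: minor2_def algebra_simps)
    then have "indet (XVar x) * minor2 i y \<in> Q" "indet (YVar x) * minor2 i y \<in> Q"
      using ideal_poly_ring_add[OF I] ideal_poly_ring_mult[OF I] indet_in_poly_ring i y edge[OF xy(1)] 2(3)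
      by metis+
    moreover have "indet (XVar x) \<notin> Q \<or> indet (YVar x) \<notin> Q"
      using xy(2) x by (simp add: U_def)
    ultimately show ?case
      using Q.I_prime[of _ "minor2 i y"] indet_in_poly_ring[OF x] minor2_in_poly_ring[OF i y] by auto
  qed
  then show "P_ideal n H U \<subseteq> Q"
    unfolding P_ideal_subset_iff[OF U I] by (auto simp: component_of_def U_def)
qed

text \<open>
  There are finitely many ideals \<open>P\<^sub>T\<close>; one that is minimal among them is a minimal prime, because every
  prime over the binomial edge ideal contains some \<open>P\<^sub>U\<close>.
\<close>

lemma minimal_prime_below_P_ideal:
  assumes "S \<subseteq> {1..n}"
  obtains T where "T \<subseteq> {1..n}" and "(P_ideal n H T :: 'k::field mpoly set) \<subseteq> P_ideal n H S"
    and "(P_ideal n H T :: 'k mpoly set) \<in> minimal_primes (poly_ring n) (binomial_edge_ideal n H)"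
proof -
  let ?P = "P_ideal n H :: nat set \<Rightarrow> 'k mpoly set"
  have "finite (?P ` Pow {1..n})" "?P S \<in> ?P ` Pow {1..n}"
    using assms by auto
  from finite_has_minimal2[OF this] obtain T where T: "T \<subseteq> {1..n}" "?P T \<subseteq> ?P S"
    and min: "\<And>U. U \<subseteq> {1..n} \<Longrightarrow> ?P U \<subseteq> ?P T \<Longrightarrow> ?P T = ?P U"
    by auto
  have "?P T \<in> minimal_primes (poly_ring n) (binomial_edge_ideal n H)"
    unfolding minimal_primes_def
  proof (intro CollectI conjI allI impI; (elim conjE)?)
    show "primeideal (?P T) (poly_ring n)"
      unfolding P_ideal_eq_toric_ideal[OF T(1)] by (rule primeideal_toric_ideal)
    show "binomial_edge_ideal n H \<subseteq> ?P T"
      by (rule binomial_edge_ideal_subset_P_ideal[OF T(1)])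
    fix Q assume Q: "primeideal Q (poly_ring n)" "binomial_edge_ideal n H \<subseteq> Q" "Q \<subseteq> ?P T"
    obtain U where "U \<subseteq> {1..n}" "?P U \<subseteq> Q"
      using prime_contains_P_ideal[OF Q(1,2)] .
    with min[of U] Q(3) show "Q = ?P T" by blast
  qed
  with T that show thesis by blast
qed

text \<open>
  If the labeling is weakly closed, no vertex outside \<open>C \<union> S\<close> can be jumped over by an edge inside a
  component \<open>C\<close>, as it would be adjacent to an end of that edge. A path in \<open>C\<close> from \<open>Min C\<close> therefore
  never passes it, and \<open>C\<close> fills its interval up to \<open>S\<close>.

  Conversely, let \<open>i < j < k\<close> violate the condition. With \<open>S\<close> the complement of \<open>{i, j, k}\<close>, the vertex \<open>j\<close> is
  isolated, so the minor of the columns \<open>i, j\<close> is not in \<open>P\<^sub>S\<close>. This persists in a minimal prime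
  \<open>P\<^sub>T \<subseteq> P\<^sub>S\<close>, and there \<open>j\<close> lies in the interval of the component of \<open>i\<close> and \<open>k\<close> without
  belonging to \<open>T\<close> or to that component.
\<close>

lemma weakly_closed_labeling_iff:
  "(\<forall>i j k. 1 \<le> i \<and> i < j \<and> j < k \<and> k \<le> n \<longrightarrow> (i, k) \<in> parcs H \<longrightarrow> (i, j) \<in> parcs H \<or> (j, k) \<in> parcs H)
   \<longleftrightarrow> (\<forall>S\<subseteq>{1..n}.
        (P_ideal n H S :: 'k::field mpoly set) \<in> minimal_primes (poly_ring n) (binomial_edge_ideal n H) \<longrightarrow>
        (P_ideal n H S :: 'k mpoly set) = P_bar_ideal n H S)"
  (is "?weak \<longleftrightarrow> ?min")
proof
  assume weak: ?weak
  have "{Min C..Max C} \<subseteq> C \<union> S" if C_comp: "C \<in> components_minus H S" for C S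
  proof (intro subsetI, rule ccontr)
    fix v assume v: "v \<in> {Min C..Max C}" "v \<notin> C \<union> S"
    obtain i where i: "i \<in> pverts H - S" and Ci: "C = component_of H S i"
      using C_comp by (auto simp: components_minus_eq)
    have C: "Min C \<in> C" "Max C \<in> C"
      using component_bounds[OF component_of_self[OF i]] unfolding Ci by blast+
    have MinC: "Min C \<in> pverts H - S" using C(1) component_of_subset unfolding Ci by blast
    have eq: "component_of H S x = C" if "x \<in> C" for x
      using that component_of_eq_iff[OF i, of x] component_of_subset unfolding Ci by blast
    have "y < v" if "Min C \<rightarrow>\<^sup>*\<^bsub>minus_verts S\<^esub> y" for y
      using that
    proof (induction rule: wf_digraph.reachable_induct[OF wf_minus_verts, consumes 1])
      case 1
      show ?case using v C(1) by (metis UnI1 atLeastAtMost_iff le_neq_implies_less)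
    next
      case (2 x y)
      have x: "x \<in> C"
        using 2(1) eq[OF C(1)] by (auto simp: component_of_def)
      have xy: "(x, y) \<in> parcs H" "x \<notin> S" "y \<notin> S"
        using 2(2) by (auto simp: minus_verts_arcs)
      then have y: "y \<in> C"
        using component_of_adj eq[OF x] by blast
      have "v \<notin> S" "x \<in> {1..n}" "y \<in> {1..n}"
        using v wellformed'[OF xy(1)] by (auto simp: pverts_eq)
      show ?case
      proof (rule ccontr)
        assume "\<not> y < v"
        then have "v < y" using y v(2) by (metis UnI1 nat_neq_iff)
        then have "(x, v) \<in> parcs H \<or> (v, y) \<in> parcs H"
          using weak 2(3) xy(1) \<open>x \<in> {1..n}\<close> \<open>y \<in> {1..n}\<close> by auto
        then have "(x, v) \<in> parcs H \<or> (y, v) \<in> parcs H"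
          using pair_sym_arcs by (auto simp: symmetric_def dest: symD)
        then show False
          using component_of_adj \<open>v \<notin> S\<close> xy(2,3) eq[OF x] eq[OF y] v(2) by blast
      qed
    qed
    moreover have "Min C \<rightarrow>\<^sup>*\<^bsub>minus_verts S\<^esub> Max C"
      using C(2) eq[OF C(1)] by (auto simp: component_of_def)
    ultimately have "Max C < v" .
    then show False using v by simp
  qed
  then show ?min
    using P_ideal_eq_P_bar_ideal_iff by blast
next
  assume min: ?min
  show ?weak
  proof (intro allI impI, rule ccontr)
    fix i j k assume ijk: "1 \<le> i \<and> i < j \<and> j < k \<and> k \<le> n" and ik: "(i, k) \<in> parcs H"
      and no: "\<not> ((i, j) \<in> parcs H \<or> (j, k) \<in> parcs H)"
    define S where "S = {1..n} - {i, j, k}"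
    have S: "S \<subseteq> {1..n}" by (auto simp: S_def)
    obtain T where T: "T \<subseteq> {1..n}" and TS: "(P_ideal n H T :: 'k mpoly set) \<subseteq> P_ideal n H S"
      and "(P_ideal n H T :: 'k mpoly set) \<in> minimal_primes (poly_ring n) (binomial_edge_ideal n H)"
      using minimal_prime_below_P_ideal[OF S] .
    then have convex: "\<forall>C\<in>components_minus H T. {Min C..Max C} \<subseteq> C \<union> T"
      using min P_ideal_eq_P_bar_ideal_iff[OF T, where 'k = 'k] by blast
    \<comment> \<open>The variables in \<open>P\<^sub>T \<subseteq> P\<^sub>S\<close> show \<open>T \<subseteq> S\<close>.\<close>
    have "t \<in> S" if "t \<in> T" for t
      using that T TS indet_in_P_ideal_iff[OF T, of t, where 'k = 'k]
        indet_in_P_ideal_iff[OF S, of t, where 'k = 'k] by blast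
    then have notT: "i \<notin> T" "j \<notin> T" "k \<notin> T"
      by (auto simp: S_def)
    have range: "i \<in> {1..n}" "j \<in> {1..n}" using ijk by auto
    let ?C = "component_of H T i"
    have iC: "i \<in> ?C"
      using component_of_self range notT by (simp add: pverts_eq)
    have kC: "k \<in> ?C"
      using component_of_adj[OF ik] notT by blast
    have "?C \<in> components_minus H T"
      unfolding components_minus_eq pverts_eq using range(1) notT(1) by blast
    moreover have "j \<in> {Min ?C..Max ?C}"
      using component_bounds(2)[OF iC] component_bounds(4)[OF kC] ijk by simp
    ultimately have "j \<in> ?C \<union> T"
      using convex by blast
    then have "minor2 i j \<in> (P_ideal n H T :: 'k mpoly set)"
      using minor2_in_P_ideal_iff[OF T range] by blast
    then have "minor2 i j \<in> (P_ideal n H S :: 'k mpoly set)"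
      using TS by blast
    then have "i \<rightarrow>\<^sup>*\<^bsub>minus_verts S\<^esub> j"
      using minor2_in_P_ideal_iff[OF S range] by (auto simp: S_def component_of_def)
    then have "j \<in> {i, k}"
    proof (induction rule: wf_digraph.reachable_induct[OF wf_minus_verts, consumes 1])
      case (2 x y)
      have "(x, y) \<in> parcs H" "y \<notin> S"
        using 2(2) by (auto simp: minus_verts_arcs)
      moreover have "y \<in> {1..n}"
        using calculation(1) wellformed' by (auto simp: pverts_eq)
      moreover have "(k, j) \<notin> parcs H"
        using no pair_sym_arcs by (auto simp: symmetric_def dest: symD)
      ultimately show ?case
        using 2(3) no by (auto simp: S_def)
    qed simp
    then show False using ijk by auto
  qed
qed

end

theorem proposition2:
  fixes G :: "'v pair_pre_digraph" and n :: nat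
  assumes "pair_graph G"
    and "Digraph_Component.connected (with_proj G)"
    and "card (pverts G) = n"
  shows "weakly_closed G \<longleftrightarrow>
    (\<exists>l. labeling l G \<and>
      (\<forall>S \<subseteq> {1..n}.
        (P_ideal n (relabel l G) S :: 'k::field mpoly set)
          \<in> minimal_primes (poly_ring n) (binomial_edge_ideal n (relabel l G)) \<longrightarrow>
        (P_ideal n (relabel l G) S :: 'k mpoly set) = P_bar_ideal n (relabel l G) S))"
proof -
  have "numbered_graph (relabel l G) n" if "labeling l G" for l
    using pair_sym_digraph_relabel[OF assms(1)] pverts_relabel[OF that] assms(3)
    by (simp add: numbered_graph_def numbered_graph_axioms_def)
  then show ?thesis
    unfolding weakly_closed_def assms(3)
    using numbered_graph.weakly_closed_labeling_iff[where 'k = 'k] by blast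
qed

end
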